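(* A local minimizer $Y\in\mathbb{R}^{n\times p}$ of the nonconvex program (N) provides the solution $YY^T$ of the convex program (C) if and only if the matrix $$S_Y=\nabla_X f(YY^T)-\sum_{i=1}^m\lambda_iA_i$$ is positive semidefinite for the Lagrangian multipliers $\lambda_1,\dots,\lambda_m\in\mathbb{R}$ that satisfy the first-order optimality conditions of (N) at $Y$, namely $$\mathrm{Tr}(Y^TA_iY)=b_i,\quad i=1,\dots,m,\qquad \Big(\nabla_X f(YY^T)-\sum_{i=1}^m\lambda_iA_i\Big)Y=0 .$$
   Context: Let $\mathbb{S}^n$ be the space of real symmetric $n\times n$ matrices, with the Frobenius inner product $\langle Z_1,Z_2\rangle=\mathrm{Tr}(Z_1^TZ_2)$. Let $f:\mathbb{S}^n\to\mathbb{R}$ be convex and differentiable; $\nabla_X f(X)$ denotes its gradient at $X$, so that the directional derivative of $f$ at $X$ in the direction $Z$ is $\langle\nabla_Xf(X),Z\rangle$. Let $A_1,\dots,A_m\in\mathbb{S}^n$ and $b_1,\dots,b_m\in\mathbb{R}$, and assume $A_iA_j=0$ for all $i\ne j$. The convex program (C) is: minimize $f(X)$ over $X\in\mathbb{S}^n$ subject to $\mathrm{Tr}(A_iX)=b_i$ for $i=1,\dots,m$ and $X\succeq0$. For a positive integer $p$, the nonconvex program (N) is: minimize $f(YY^T)$ over $Y\in\mathbb{R}^{n\times p}$ subject to $\mathrm{Tr}(Y^TA_iY)=b_i$ for $i=1,\dots,m$.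
   Formalization: The "only if" direction, and the existence and uniqueness of the multipliers, are stated for Y at which the matrices A_iY are linearly independent (automatic if all b_i are nonzero); the "if" direction holds for every multiplier vector. *)

theory Defs
  imports "HOL-Analysis.Analysis"
begin

definition sym_mats :: "(real^'n^'n) set" where
  "sym_mats = {X. transpose X = X}"

definition psd :: "real^'n^'n \<Rightarrow> bool" where
  "psd X \<longleftrightarrow> X \<in> sym_mats \<and> (\<forall>v. 0 \<le> v \<bullet> (X *v v))"

definition frobenius_inner :: "real^'n^'n \<Rightarrow> real^'n^'n \<Rightarrow> real" where
  "frobenius_inner Z1 Z2 = trace (transpose Z1 ** Z2)"

text \<open>The distance on \<^typ>\<open>real^'n^'n\<close> is the one induced by this inner product.\<close>

lemma frobenius_inner_eq_inner: "frobenius_inner Z1 Z2 = Z1 \<bullet> Z2"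
  unfolding frobenius_inner_def trace_def matrix_matrix_mult_def transpose_def inner_vec_def
  by (subst sum.swap) simp

text \<open>
  A function on the space of symmetric matrices is modelled by a function on all square matrices
  of which only the values on \<^const>\<open>sym_mats\<close> are used. Differentiability is taken within this
  subspace, so the derivative is only determined on symmetric directions; it is the requirement
  that \<open>G\<close> be symmetric that makes the gradient unique.
\<close>

definition has_sym_gradient ::
    "(real^'n^'n \<Rightarrow> real) \<Rightarrow> real^'n^'n \<Rightarrow> real^'n^'n \<Rightarrow> bool" where
  "has_sym_gradient f G X \<longleftrightarrow>
     G \<in> sym_mats \<and> (f has_derivative (\<lambda>Z. frobenius_inner G Z)) (at X within sym_mats)"

definition feasible_C :: "nat \<Rightarrow> (nat \<Rightarrow> real^'n^'n) \<Rightarrow> (nat \<Rightarrow> real) \<Rightarrow> (real^'n^'n) set" where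
  "feasible_C m A b = {X. (\<forall>i\<in>{1..m}. trace (A i ** X) = b i) \<and> psd X}"

text \<open>A matrix with \<open>n\<close> rows and \<open>p\<close> columns has type \<^typ>\<open>real^'p^'n\<close>.\<close>

definition feasible_N :: "nat \<Rightarrow> (nat \<Rightarrow> real^'n^'n) \<Rightarrow> (nat \<Rightarrow> real) \<Rightarrow> (real^'p^'n) set" where
  "feasible_N m A b = {Y. \<forall>i\<in>{1..m}. trace (transpose Y ** A i ** Y) = b i}"

definition solves_C ::
    "(real^'n^'n \<Rightarrow> real) \<Rightarrow> nat \<Rightarrow> (nat \<Rightarrow> real^'n^'n) \<Rightarrow> (nat \<Rightarrow> real) \<Rightarrow> real^'n^'n \<Rightarrow> bool" where
  "solves_C f m A b X \<longleftrightarrow> is_arg_min f (\<lambda>X. X \<in> feasible_C m A b) X"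

definition local_minimizer_N ::
    "(real^'n^'n \<Rightarrow> real) \<Rightarrow> nat \<Rightarrow> (nat \<Rightarrow> real^'n^'n) \<Rightarrow> (nat \<Rightarrow> real) \<Rightarrow> real^'p^'n \<Rightarrow> bool" where
  "local_minimizer_N f m A b Y \<longleftrightarrow>
     Y \<in> feasible_N m A b \<and>
     (\<exists>\<epsilon>>0. \<forall>Y'\<in>feasible_N m A b. dist Y' Y < \<epsilon> \<longrightarrow>
        f (Y ** transpose Y) \<le> f (Y' ** transpose Y'))"

definition S_mat ::
    "(real^'n^'n \<Rightarrow> real^'n^'n) \<Rightarrow> nat \<Rightarrow> (nat \<Rightarrow> real^'n^'n) \<Rightarrow> (nat \<Rightarrow> real) \<Rightarrow> real^'p^'n
      \<Rightarrow> real^'n^'n" where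
  "S_mat grad m A lam Y = grad (Y ** transpose Y) - (\<Sum>i=1..m. lam i *\<^sub>R A i)"

definition first_order_N ::
    "(real^'n^'n \<Rightarrow> real^'n^'n) \<Rightarrow> nat \<Rightarrow> (nat \<Rightarrow> real^'n^'n) \<Rightarrow> (nat \<Rightarrow> real) \<Rightarrow> (nat \<Rightarrow> real)
      \<Rightarrow> real^'p^'n \<Rightarrow> bool" where
  "first_order_N grad m A b lam Y \<longleftrightarrow>
     (\<forall>i\<in>{1..m}. trace (transpose Y ** A i ** Y) = b i) \<and> S_mat grad m A lam Y ** Y = 0"

text \<open>
  Linear independence constraint qualification: the gradient at \<open>Y\<close> of the \<open>i\<close>-th constraint
  function \<open>Tr(Y\<^sup>T A\<^sub>i Y)\<close> is \<open>2 A\<^sub>i Y\<close>. It is linear independence of the family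
  (the \<open>A\<^sub>i Y\<close> are not assumed distinct), and it is what makes the multipliers at \<open>Y\<close> unique.
  Since \<open>Tr(Y\<^sup>T A\<^sub>i Y) = b\<^sub>i\<close> and the \<open>A\<^sub>i\<close> are mutually orthogonal, it can only fail at a
  feasible \<open>Y\<close> when some \<open>b\<^sub>i\<close> is zero.
\<close>

definition licq_N :: "nat \<Rightarrow> (nat \<Rightarrow> real^'n^'n) \<Rightarrow> real^'p^'n \<Rightarrow> bool" where
  "licq_N m A Y \<longleftrightarrow>
     (\<forall>c :: nat \<Rightarrow> real. (\<Sum>i=1..m. c i *\<^sub>R (A i ** Y)) = 0 \<longrightarrow> (\<forall>i\<in>{1..m}. c i = 0))"

end

theory Submission
  imports Defs
begin

text \<open>
  Write \<open>X0 = Y Y\<^sup>T\<close>, \<open>G\<close> for the gradient of \<open>f\<close> at \<open>X0\<close>, and \<open>S = G - \<Sum>\<^sub>i \<lambda>\<^sub>i A\<^sub>i\<close>.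

  If \<open>S\<close> is positive semidefinite and \<open>S Y = 0\<close>, then \<open>X0\<close> is optimal by weak duality. For feasible
  \<open>X\<close> the multiplier terms of \<open>\<langle>G, X - X0\<rangle>\<close> vanish, because \<open>X\<close> and \<open>X0\<close> satisfy the same linear
  constraints, and \<open>\<langle>S, X0\<rangle> = 0\<close> because \<open>S Y = 0\<close>. What is left is \<open>\<langle>S, X\<rangle>\<close>, which is nonnegative as a product of
  two positive semidefinite matrices (\<open>psd_inner_nonneg\<close>), and convexity turns
  \<open>\<langle>G, X - X0\<rangle> \<ge> 0\<close> into \<open>f X0 \<le> f X\<close> (\<open>convex_gradient_inequality\<close>).

  Now let the \<open>A\<^sub>i Y\<close> be linearly independent, so that the multipliers are unique. Both their
  existence and the converse implication are obtained by moving \<open>X0\<close> along curves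
  \<open>z(t) z(t)\<^sup>T + t V\<close> with \<open>z(0) = Y\<close> that stay on the linear constraints; minimality makes the
  derivative of \<open>f\<close> along such a curve nonnegative at \<open>t = 0\<close> (\<open>feasible_variation\<close>).
  With \<open>V = 0\<close> the curve is feasible for (N). Taking for \<open>z'(0)\<close> the negative of the component of
  \<open>G Y\<close> orthogonal to all \<open>A\<^sub>i Y\<close>, one finds that this component is zero, so \<open>G Y\<close> is a combination of
  the \<open>A\<^sub>i Y\<close>, which is the first-order condition. With \<open>V = v v\<^sup>T\<close> the curve is feasible for (C) when
  \<open>t \<ge> 0\<close>, and if \<open>z'(0)\<close> is chosen to compensate the effect of \<open>V\<close> on the constraints,
  then the derivative of \<open>f\<close> is exactly \<open>v\<^sup>T S v\<close>.

  These curves need no implicit function theorem. Since \<open>A\<^sub>i A\<^sub>j = 0\<close> for \<open>i \<noteq> j\<close>, adding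
  \<open>s\<^sub>i A\<^sub>i Y\<close> to a point changes only the \<open>i\<close>-th constraint. A given first-order motion can therefore be
  put back on the constraints by solving one scalar quadratic equation for each \<open>i\<close>
  (\<open>quadratic_constraint_curve\<close>); the equation has a small root because \<open>A\<^sub>i Y \<noteq> 0\<close>
  by linear independence.
\<close>

section \<open>Matrix products and the Frobenius inner product\<close>

lemma bounded_bilinear_matrix_mult:
  "bounded_bilinear ((**) :: real^'k^'n \<Rightarrow> real^'p^'k \<Rightarrow> real^'p^'n)"
proof -
  have "bilinear ((**) :: real^'k^'n \<Rightarrow> real^'p^'k \<Rightarrow> real^'p^'n)"
    unfolding bilinear_def
    by (auto intro!: linearI simp: matrix_add_ldistrib vec_eq_iff matrix_matrix_mult_def
        distrib_left distrib_right sum.distrib sum_distrib_left mult.left_commute mult.assoc)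
  then show ?thesis
    by (simp add: bilinear_conv_bounded_bilinear)
qed

interpretation matrix_mult: bounded_bilinear "(**) :: real^'k^'n \<Rightarrow> real^'p^'k \<Rightarrow> real^'p^'n"
  by (rule bounded_bilinear_matrix_mult)

lemma linear_transpose: "linear (transpose :: real^'p^'n \<Rightarrow> real^'n^'p)"
  by (auto intro!: linearI simp: transpose_def vec_eq_iff)

lemma inner_matrix_mult_left:
  fixes B :: "real^'k^'n" and C :: "real^'p^'k" and D :: "real^'p^'n"
  shows "D \<bullet> (B ** C) = (transpose B ** D) \<bullet> C"
proof -
  have "D \<bullet> (B ** C) = (\<Sum>i\<in>UNIV. \<Sum>k\<in>UNIV. \<Sum>j\<in>UNIV. D$i$j * (B$i$k * C$k$j))"
    unfolding inner_vec_def matrix_matrix_mult_def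
    by (simp add: sum_distrib_left) (subst sum.swap, rule refl)
  also have "\<dots> = (\<Sum>k\<in>UNIV. \<Sum>j\<in>UNIV. \<Sum>i\<in>UNIV. D$i$j * (B$i$k * C$k$j))"
    by (subst sum.swap) (intro sum.cong refl sum.swap)
  also have "\<dots> = (transpose B ** D) \<bullet> C"
    unfolding inner_vec_def matrix_matrix_mult_def transpose_def
    by (simp add: sum_distrib_left mult_ac)
  finally show ?thesis .
qed

lemma inner_transpose_transpose:
  fixes B C :: "real^'p^'n"
  shows "transpose B \<bullet> transpose C = B \<bullet> C"
  unfolding inner_vec_def transpose_def by simp (rule sum.swap)

lemma inner_matrix_mult_right:
  fixes B :: "real^'k^'n" and C :: "real^'p^'k" and D :: "real^'p^'n"
  shows "D \<bullet> (B ** C) = (D ** transpose C) \<bullet> B"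
  using inner_matrix_mult_left[of "transpose D" "transpose C" "transpose B"]
    inner_transpose_transpose[of D "B ** C"] inner_transpose_transpose[of "D ** transpose C" B]
  by (simp add: matrix_transpose_mul)

lemma sym_matsD: "X \<in> sym_mats \<Longrightarrow> transpose X = X"
  by (simp add: sym_mats_def)

lemma subspace_sym_mats: "subspace sym_mats"
  by (auto simp: subspace_def sym_mats_def linear_add[OF linear_transpose]
      linear_cmul[OF linear_transpose] linear_0[OF linear_transpose])

lemma inner_sym_matrix_mult:
  fixes B :: "real^'n^'n" and C D :: "real^'p^'n"
  assumes "B \<in> sym_mats"
  shows "(B ** C) \<bullet> D = C \<bullet> (B ** D)"
  using inner_matrix_mult_left[of D B C] sym_matsD[OF assms] by (simp add: inner_commute)

lemma inner_gram:
  fixes B :: "real^'n^'k" and C :: "real^'p^'k" and D :: "real^'p^'n"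
  shows "B \<bullet> (C ** transpose D) = (B ** D) \<bullet> C"
  using inner_matrix_mult_right[of B C "transpose D"] by simp

lemma trace_sym_matrix_mult:
  fixes B X :: "real^'n^'n"
  assumes "B \<in> sym_mats"
  shows "trace (B ** X) = B \<bullet> X"
  using frobenius_inner_eq_inner[of B X] sym_matsD[OF assms] by (simp add: frobenius_inner_def)

lemma trace_quadratic:
  fixes B :: "real^'n^'n" and Y :: "real^'p^'n"
  shows "trace (transpose Y ** B ** Y) = Y \<bullet> (B ** Y)"
proof -
  have "trace (transpose Y ** (B ** Y)) = Y \<bullet> (B ** Y)"
    unfolding trace_def matrix_matrix_mult_def transpose_def inner_vec_def
    by (subst sum.swap) simp
  then show ?thesis
    by (simp add: matrix_mul_assoc)
qed

lemma gram_mem_sym_mats: "Y ** transpose Y \<in> sym_mats"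
  by (simp add: sym_mats_def matrix_transpose_mul)

lemma psd_gram: "psd (Y ** transpose Y)"
proof -
  have "v \<bullet> ((Y ** transpose Y) *v v) = (transpose Y *v v) \<bullet> (transpose Y *v v)" for v
    by (metis dot_lmul_matrix matrix_vector_mul_assoc transpose_matrix_vector)
  then show ?thesis
    unfolding psd_def using gram_mem_sym_mats by simp
qed

text \<open>
  Rank-one matrices \<open>v v\<^sup>T\<close> are written as \<open>P P\<^sup>T\<close> with a one-column matrix \<open>P\<close>, so that
  the facts about \<open>Y Y\<^sup>T\<close> for rectangular \<open>Y\<close> apply to them.
\<close>

lemma inner_rank_one:
  fixes v :: "real^'n"
  defines "V \<equiv> columnvector v ** transpose (columnvector v :: real^1^'n)"
  shows "B \<bullet> V = v \<bullet> (B *v v)"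
  unfolding V_def columnvector_def matrix_matrix_mult_def matrix_vector_mult_def transpose_def
    inner_vec_def
  by (simp add: sum_distrib_left mult_ac)

lemma rank_one_mult_vector:
  fixes x v :: "real^'n"
  shows "(columnvector x ** transpose (columnvector x :: real^1^'n)) *v v = (x \<bullet> v) *\<^sub>R x"
  unfolding columnvector_def matrix_matrix_mult_def matrix_vector_mult_def transpose_def
    inner_vec_def
  by (simp add: vec_eq_iff sum_distrib_left sum_distrib_right mult_ac)

lemma psdD_sym: "psd X \<Longrightarrow> X \<in> sym_mats"
  and psdD_nonneg: "psd X \<Longrightarrow> 0 \<le> v \<bullet> (X *v v)"
  by (auto simp: psd_def)

lemma psd_add: "psd X \<Longrightarrow> psd X' \<Longrightarrow> psd (X + X')"
  unfolding psd_def
  by (auto simp: subspace_add[OF subspace_sym_mats] matrix_vector_mult_add_rdistrib inner_add_right)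

lemma psd_scaleR: "psd X \<Longrightarrow> 0 \<le> t \<Longrightarrow> psd (t *\<^sub>R X)"
  unfolding psd_def
  by (auto simp: subspace_scale[OF subspace_sym_mats] simp flip: scaleR_matrix_vector_assoc)

section \<open>The Frobenius product of positive semidefinite matrices\<close>

lemma quadratic_form_shift_axis:
  assumes "X \<in> sym_mats"
  shows "(v - \<alpha> *\<^sub>R axis i 1) \<bullet> (X *v (v - \<alpha> *\<^sub>R axis i 1)) =
    v \<bullet> (X *v v) - 2 * \<alpha> * (X $ i \<bullet> v) + \<alpha>\<^sup>2 * X $ i $ i"
proof -
  have ax: "X *v axis i 1 = X $ i"
    using sym_matsD[OF assms] by (metis matrix_vector_mul_component transpose_def column_def
        matrix_vector_mult_basis row_def row_transpose vec_nth_inverse)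
  show ?thesis
    by (simp add: matrix_vector_mult_diff_distrib matrix_vector_mult_scaleR inner_diff_left
        inner_diff_right ax inner_axis' matrix_vector_mul_component inner_commute[of v] power2_eq_square algebra_simps)
qed

text \<open>
  Moving from the row \<open>x = X $ i\<close> along the axis \<open>i\<close> changes the quadratic form affinely when the
  diagonal entry is zero, with slope \<open>-2 (x \<bullet> x)\<close>; a nonnegative affine function has slope zero.
\<close>

lemma psd_zero_diagonal:
  assumes "psd X" and "X $ i $ i = 0"
  shows "X $ i = 0"
proof (rule ccontr)
  assume "X $ i \<noteq> 0"
  then have pos: "0 < X $ i \<bullet> X $ i"
    by simp
  define q where "q = X $ i \<bullet> (X *v (X $ i))"
  have "0 \<le> q - 2 * \<alpha> * (X $ i \<bullet> X $ i)" for \<alpha>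
    using psdD_nonneg[OF assms(1), of "X $ i - \<alpha> *\<^sub>R axis i 1"] assms(2)
    by (simp add: quadratic_form_shift_axis[OF psdD_sym[OF assms(1)]] q_def)
  \<comment> \<open>At this \<open>\<alpha>\<close> the right-hand side is \<open>-1\<close>.\<close>
  from this[of "(q + 1) / (2 * (X $ i \<bullet> X $ i))"] pos show False
    by simp
qed

text \<open>
  The value of the new form at \<open>v\<close> is the minimum of the old one over the line \<open>v + \<real> e\<^sub>i\<close>.
\<close>

lemma psd_schur_complement:
  fixes X :: "real^'n^'n"
  assumes "psd X" and "0 < X $ i $ i"
  shows "psd (X - inverse (X $ i $ i) *\<^sub>R
    (columnvector (X $ i) ** transpose (columnvector (X $ i) :: real^1^'n)))"
  unfolding psd_def
proof (intro conjI allI)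
  show "X - inverse (X $ i $ i) *\<^sub>R
    (columnvector (X $ i) ** transpose (columnvector (X $ i) :: real^1^'n)) \<in> sym_mats"
    using assms(1) by (simp add: psdD_sym subspace_diff subspace_scale subspace_sym_mats
        gram_mem_sym_mats)
next
  fix v
  \<comment> \<open>The minimizer over \<open>\<alpha>\<close> of the form at \<open>v - \<alpha> *\<^sub>R axis i 1\<close>.\<close>
  define \<alpha> where "\<alpha> = (X $ i \<bullet> v) / X $ i $ i"
  have "0 \<le> (v - \<alpha> *\<^sub>R axis i 1) \<bullet> (X *v (v - \<alpha> *\<^sub>R axis i 1))"
    by (rule psdD_nonneg[OF assms(1)])
  also have "\<dots> = v \<bullet> (X *v v) - (X $ i \<bullet> v)\<^sup>2 / X $ i $ i"
    using assms(2)
    by (simp add: quadratic_form_shift_axis[OF psdD_sym[OF assms(1)]] \<alpha>_def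
        power2_eq_square field_simps)
  finally show "0 \<le> v \<bullet> ((X - inverse (X $ i $ i) *\<^sub>R
    (columnvector (X $ i) ** transpose (columnvector (X $ i) :: real^1^'n))) *v v)"
    by (simp add: matrix_vector_mult_diff_rdistrib inner_diff_right rank_one_mult_vector
        inner_commute[of v] power2_eq_square field_simps flip: scaleR_matrix_vector_assoc)
qed

text \<open>
  It suffices to peel off rank-one terms \<open>x x\<^sup>T\<close> from \<open>X\<close>, since \<open>\<langle>S, x x\<^sup>T\<rangle> = x\<^sup>T S x\<close>. Symmetric
  Gaussian elimination does so: each Schur complement stays positive semidefinite and clears one
  more row, so the induction is on a set \<open>F\<close> of indices outside of which the rows are zero.
\<close>

lemma psd_inner_nonneg:
  fixes S X :: "real^'n^'n"
  assumes "psd S" and "psd X"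
  shows "0 \<le> S \<bullet> X"
proof -
  have "psd X \<Longrightarrow> (\<And>i. i \<notin> F \<Longrightarrow> X $ i = 0) \<Longrightarrow> 0 \<le> S \<bullet> X" if "finite F" for F
    using that
  proof (induction F arbitrary: X rule: finite_induct)
    case empty
    then have "X = 0"
      by (simp add: vec_eq_iff)
    then show ?case
      by simp
  next
    case (insert i F)
    show ?case
    proof (cases "X $ i $ i = 0")
      case True
      then have "X $ i = 0"
        using insert.prems(1) by (rule psd_zero_diagonal[rotated])
      then show ?thesis
        using insert.prems insert.IH by (metis insert_iff)
    next
      case False
      have "X $ i $ i = axis i 1 \<bullet> (X *v axis i 1)"
        by (simp add: inner_axis' matrix_vector_mul_component inner_axis)
      with False have pos: "0 < X $ i $ i"
        using psdD_nonneg[OF insert.prems(1), of "axis i 1"] by simp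
      define V where "V = columnvector (X $ i) ** transpose (columnvector (X $ i) :: real^1^'n)"
      define X' where "X' = X - inverse (X $ i $ i) *\<^sub>R V"
      have V_nth: "V $ j $ k = X $ i $ j * X $ i $ k" for j k
        by (simp add: V_def columnvector_def matrix_matrix_mult_def transpose_def)
      have sym: "X $ i $ j = X $ j $ i" for j
        using sym_matsD[OF psdD_sym[OF insert.prems(1)]] by (metis transpose_def vec_lambda_beta)
      have "psd X'"
        unfolding X'_def V_def by (rule psd_schur_complement[OF insert.prems(1) pos])
      moreover have "X' $ j = 0" if "j \<notin> F" for j
      proof (cases "j = i")
        case True
        then show ?thesis
          using pos by (simp add: X'_def V_nth vec_eq_iff)
      next
        case False
        with that have "X $ j = 0"
          using insert.prems(2) by blast
        with sym[of j] show ?thesis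
          by (simp add: X'_def V_nth vec_eq_iff)
      qed
      ultimately have "0 \<le> S \<bullet> X'"
        by (rule insert.IH)
      moreover have "0 \<le> S \<bullet> V"
        unfolding V_def inner_rank_one by (rule psdD_nonneg[OF assms(1)])
      moreover have "S \<bullet> X = S \<bullet> X' + inverse (X $ i $ i) * (S \<bullet> V)"
        by (simp add: X'_def inner_diff_right)
      ultimately show ?thesis
        using pos by simp
    qed
  qed
  from this[of UNIV] assms(2) show ?thesis
    by simp
qed

section \<open>Feasible curves\<close>

text \<open>
  The root of \<open>c s\<^sup>2 + 2 u s = r\<close> that tends to \<open>0\<close> with \<open>r\<close> is taken in the form
  \<open>s = r / (u + sqrt (u\<^sup>2 + c r))\<close>, which also covers \<open>c = 0\<close> and is differentiable wherever
  \<open>u > 0\<close> and \<open>u\<^sup>2 + c r > 0\<close>. Here \<open>u = a + t e\<close> and \<open>r = t\<^sup>2 q\<close>; as \<open>r\<close> is of second order in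
  \<open>t\<close>, the root has derivative zero.
\<close>

lemma quadratic_small_root:
  fixes a c e q :: real
  assumes "0 < a"
  obtains s where "s 0 = 0" and "(s has_real_derivative 0) (at 0)"
    and "\<forall>\<^sub>F t in at 0. 2 * (a + t * e) * s t + c * (s t)\<^sup>2 = t\<^sup>2 * q"
proof
  define D where "D t = (a + t * e)\<^sup>2 + c * (t\<^sup>2 * q)" for t
  define s where "s t = t\<^sup>2 * q / (a + t * e + sqrt (D t))" for t
  show "s 0 = 0"
    by (simp add: s_def)
  show "(s has_real_derivative 0) (at 0)"
    unfolding s_def D_def using assms
    by (auto intro!: derivative_eq_intros)
  have "(D \<longlongrightarrow> D 0) (at 0)" "((\<lambda>t. a + t * e) \<longlongrightarrow> a + 0 * e) (at 0)"
    unfolding D_def by (intro tendsto_intros)+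
  moreover have "0 < D 0" and "0 < a + 0 * e"
    using assms by (simp_all add: D_def)
  ultimately have "\<forall>\<^sub>F t in at 0. 0 < D t \<and> 0 < a + t * e"
    by (intro eventually_conj) (auto dest: order_tendstoD(1))
  then show "\<forall>\<^sub>F t in at 0. 2 * (a + t * e) * s t + c * (s t)\<^sup>2 = t\<^sup>2 * q"
  proof eventually_elim
    case (elim t)
    define u where "u = a + t * e"
    define w where "w = sqrt (D t)"
    define r where "r = t\<^sup>2 * q"
    have "0 < u" and "0 < w" and "w\<^sup>2 = D t"
      using elim by (auto simp: u_def w_def)
    then have nz: "u + w \<noteq> 0"
      by simp
    with \<open>w\<^sup>2 = D t\<close> have w: "c * r = (w - u) * (w + u)"
      by (simp add: D_def u_def r_def power2_eq_square algebra_simps)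
    have s: "s t = r / (u + w)"
      by (simp add: s_def u_def w_def r_def)
    have "c * (s t)\<^sup>2 = (c * r) * r / (u + w)\<^sup>2"
      by (simp add: s power2_eq_square)
    also have "\<dots> = (w - u) * r / (u + w)"
      using nz by (simp add: w power2_eq_square add.commute)
    finally have "2 * u * s t + c * (s t)\<^sup>2 = (u + w) * r / (u + w)"
      by (simp add: s add_divide_distrib[symmetric] algebra_simps)
    then show ?case
      using nz by (simp add: u_def r_def)
  qed
qed

text \<open>
  The straight line \<open>u(t) = y + t w\<close> misses the prescribed values
  \<open>\<langle>y, L\<^sub>k y\<rangle> + 2 t \<langle>L\<^sub>k y, w\<rangle>\<close> by \<open>t\<^sup>2 \<langle>w, L\<^sub>k w\<rangle>\<close>. For \<open>p = \<Sum>\<^sub>i s\<^sub>i L\<^sub>i y\<close> orthogonality gives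
  \<open>L\<^sub>k p = s\<^sub>k L\<^sub>k (L\<^sub>k y)\<close>, so the \<open>k\<close>-th value at \<open>u(t) + p\<close> depends on \<open>s\<^sub>k\<close> alone, and
  removing the error is a quadratic equation for \<open>s\<^sub>k\<close> with linear coefficient near
  \<open>2 \<parallel>L\<^sub>k y\<parallel>\<^sup>2 > 0\<close>.
\<close>

lemma quadratic_constraint_curve:
  fixes L :: "'i \<Rightarrow> 'a::real_inner \<Rightarrow> 'a"
  assumes "finite I"
    and lin: "\<And>k. k \<in> I \<Longrightarrow> linear (L k)"
    and adj: "\<And>k x y. k \<in> I \<Longrightarrow> L k x \<bullet> y = x \<bullet> L k y"
    and orth: "\<And>i k x. i \<in> I \<Longrightarrow> k \<in> I \<Longrightarrow> i \<noteq> k \<Longrightarrow> L k (L i x) = 0"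
    and nz: "\<And>k. k \<in> I \<Longrightarrow> L k y \<noteq> 0"
  obtains z where "z 0 = y" and "(z has_vector_derivative w) (at 0)"
    and "\<forall>\<^sub>F t in at 0. \<forall>k\<in>I. z t \<bullet> L k (z t) = y \<bullet> L k y + 2 * t * (L k y \<bullet> w)"
proof -
  define corrects where "corrects k s \<longleftrightarrow> s 0 = 0 \<and> (s has_real_derivative 0) (at 0) \<and>
    (\<forall>\<^sub>F t in at 0. 2 * (L k y \<bullet> L k y + t * (L k (L k y) \<bullet> w)) * s t
        + (L k (L k y) \<bullet> L k y) * (s t)\<^sup>2 = t\<^sup>2 * - (w \<bullet> L k w))" for k s
  have "\<exists>s. corrects k s" if "k \<in> I" for k
  proof -
    have "0 < L k y \<bullet> L k y"
      using nz that by simp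
    then obtain s where "s 0 = 0" "(s has_real_derivative 0) (at 0)"
      "\<forall>\<^sub>F t in at 0. 2 * (L k y \<bullet> L k y + t * (L k (L k y) \<bullet> w)) * s t
        + (L k (L k y) \<bullet> L k y) * (s t)\<^sup>2 = t\<^sup>2 * - (w \<bullet> L k w)"
      by (rule quadratic_small_root)
    then show ?thesis
      unfolding corrects_def by blast
  qed
  then obtain s where s: "\<And>k. k \<in> I \<Longrightarrow> corrects k (s k)"
    by metis
  note s0 = s[unfolded corrects_def, THEN conjunct1]
    and s' = s[unfolded corrects_def, THEN conjunct2, THEN conjunct1]
    and root = s[unfolded corrects_def, THEN conjunct2, THEN conjunct2]
  define z where "z t = y + t *\<^sub>R w + (\<Sum>i\<in>I. s i t *\<^sub>R L i y)" for t
  show thesis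
  proof (rule that)
    show "z 0 = y"
      by (simp add: z_def s0)
    have "((\<lambda>t. \<Sum>i\<in>I. s i t *\<^sub>R L i y) has_vector_derivative (\<Sum>i\<in>I. s i 0 *\<^sub>R 0 + 0 *\<^sub>R L i y)) (at 0)"
      by (intro has_vector_derivative_sum has_vector_derivative_scaleR s'
          has_vector_derivative_const)
    moreover have "((\<lambda>t. y + t *\<^sub>R w) has_vector_derivative w) (at 0)"
      by (auto intro!: derivative_eq_intros)
    ultimately show "(z has_vector_derivative w) (at 0)"
      unfolding z_def using has_vector_derivative_add by fastforce
    show "\<forall>\<^sub>F t in at 0. \<forall>k\<in>I. z t \<bullet> L k (z t) = y \<bullet> L k y + 2 * t * (L k y \<bullet> w)"
    proof (rule eventually_ball_finite[OF \<open>finite I\<close>], rule ballI)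
      fix k assume k: "k \<in> I"
      interpret Lk: linear "L k"
        by (rule lin[OF k])
      from root[OF k]
      show "\<forall>\<^sub>F t in at 0. z t \<bullet> L k (z t) = y \<bullet> L k y + 2 * t * (L k y \<bullet> w)"
      proof eventually_elim
        case (elim t)
        define u where "u = y + t *\<^sub>R w"
        define p where "p = (\<Sum>i\<in>I. s i t *\<^sub>R L i y)"
        have "L k p = (\<Sum>i\<in>I. s i t *\<^sub>R L k (L i y))"
          by (simp add: p_def Lk.sum Lk.scaleR)
        also have "\<dots> = (\<Sum>i\<in>I. if i = k then s k t *\<^sub>R L k (L k y) else 0)"
          by (rule sum.cong) (auto simp: orth k)
        finally have Lp: "L k p = s k t *\<^sub>R L k (L k y)"
          using \<open>finite I\<close> k by simp
        have pp: "p \<bullet> L k p = (L k (L k y) \<bullet> L k y) * (s k t)\<^sup>2"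
          by (simp add: Lp adj[OF k, of p "L k y", unfolded Lp, symmetric] power2_eq_square)
        have up: "u \<bullet> L k p = s k t * (L k y \<bullet> L k y + t * (L k (L k y) \<bullet> w))"
          using adj[OF k, of "L k y" y]
          by (simp add: Lp u_def inner_add_left inner_commute algebra_simps)
        have uu: "u \<bullet> L k u = y \<bullet> L k y + 2 * t * (L k y \<bullet> w) + t\<^sup>2 * (w \<bullet> L k w)"
          using adj[OF k, of w y] adj[OF k, of y w]
          by (simp add: u_def Lk.add Lk.scaleR inner_add_left inner_add_right power2_eq_square
              inner_commute algebra_simps)
        have "z t = u + p"
          by (simp add: z_def u_def p_def)
        then have "z t \<bullet> L k (z t) = u \<bullet> L k u + 2 * (u \<bullet> L k p) + p \<bullet> L k p"
          using adj[OF k, of p u]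
          by (simp add: Lk.add inner_add_left inner_add_right inner_commute algebra_simps)
        with elim show ?case
          by (simp add: pp up uu algebra_simps)
      qed
    qed
  qed
qed

section \<open>First-order conditions\<close>

lemma derivative_nonneg_at_right_min:
  fixes g :: "real \<Rightarrow> real"
  assumes "(g has_real_derivative D) (at 0 within {0..})"
    and "\<forall>\<^sub>F t in at_right 0. g 0 \<le> g t"
  shows "0 \<le> D"
proof (rule ccontr)
  assume "\<not> 0 \<le> D"
  then obtain d where d: "d > 0" "\<And>h. 0 < h \<Longrightarrow> h < d \<Longrightarrow> g h < g 0"
    using has_real_derivative_neg_dec_right[OF assms(1)] by auto
  obtain b where b: "b > 0" "\<And>h. 0 < h \<Longrightarrow> h < b \<Longrightarrow> g 0 \<le> g h"
    using assms(2) by (auto simp: eventually_at_right_field)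
  have "0 < min d b / 2" "min d b / 2 < d" "min d b / 2 < b"
    using d(1) b(1) by linarith+
  with d(2) b(2) show False
    by (meson not_less)
qed

lemma has_sym_gradient_along_curve:
  assumes "has_sym_gradient f G (x 0)"
    and "(x has_vector_derivative D) (at 0 within T)"
    and "x ` T \<subseteq> sym_mats"
  shows "((\<lambda>t. f (x t)) has_real_derivative (G \<bullet> D)) (at 0 within T)"
proof -
  have "(f has_derivative (\<lambda>Z. G \<bullet> Z)) (at (x 0) within x ` T)"
    using assms(1,3) unfolding has_sym_gradient_def frobenius_inner_eq_inner
    by (blast intro: has_derivative_subset)
  from has_derivative_in_compose[OF assms(2)[unfolded has_vector_derivative_def] this]
  show ?thesis
    by (simp add: has_field_derivative_def mult_commute_abs)
qed

text \<open>
  On the segment from \<open>X\<close> to \<open>X'\<close>, the chord minus \<open>f\<close> is nonnegative and vanishes at the start, so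
  its one-sided derivative \<open>f X' - f X - \<langle>G, X' - X\<rangle>\<close> there is nonnegative.
\<close>

lemma convex_gradient_inequality:
  assumes "convex_on sym_mats f" and "has_sym_gradient f G X"
    and "X \<in> sym_mats" and "X' \<in> sym_mats"
  shows "f X + G \<bullet> (X' - X) \<le> f X'"
proof -
  define x where "x t = X + t *\<^sub>R (X' - X)" for t
  define g where "g t = (1 - t) * f X + t * f X' - f (x t)" for t
  have "x ` {0..} \<subseteq> sym_mats"
    using assms(3,4)
    by (auto simp: x_def intro!: subspace_add subspace_diff subspace_scale subspace_sym_mats)
  then have "((\<lambda>t. f (x t)) has_real_derivative (G \<bullet> (X' - X))) (at 0 within {0..})"
    by (intro has_sym_gradient_along_curve)
      (use assms(2) in \<open>auto simp: x_def intro!: derivative_eq_intros\<close>)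
  then have "(g has_real_derivative (f X' - f X - G \<bullet> (X' - X))) (at 0 within {0..})"
    unfolding g_def by (auto intro!: derivative_eq_intros)
  moreover have "\<forall>\<^sub>F t in at_right 0. g 0 \<le> g t"
  proof -
    have "g 0 \<le> g t" if "0 < t" "t < 1" for t
    proof -
      have "x t = (1 - t) *\<^sub>R X + t *\<^sub>R X'"
        by (simp add: x_def algebra_simps)
      then have "f (x t) \<le> (1 - t) * f X + t * f X'"
        using convex_onD[OF assms(1), of t X X'] assms(3,4) that by simp
      then show ?thesis
        by (simp add: g_def x_def)
    qed
    then show ?thesis
      unfolding eventually_at_right_field by (intro exI[of _ 1]) auto
  qed
  ultimately have "0 \<le> f X' - f X - G \<bullet> (X' - X)"
    by (rule derivative_nonneg_at_right_min)
  then show ?thesis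
    by simp
qed

lemma inner_constraint_gradients_sum:
  fixes Y :: "real^'p^'n" and m :: nat
  assumes sym: "\<forall>i\<in>{1..m}. A i \<in> sym_mats"
    and orth: "\<forall>i\<in>{1..m}. \<forall>j\<in>{1..m}. i \<noteq> j \<longrightarrow> A i ** A j = 0"
    and k: "k \<in> {1..m}"
  shows "(A k ** Y) \<bullet> (\<Sum>i=1..m. c i *\<^sub>R (A i ** Y)) = c k * ((A k ** Y) \<bullet> (A k ** Y))"
proof -
  have "(A k ** Y) \<bullet> (A i ** Y) = 0" if "i \<in> {1..m}" "i \<noteq> k" for i
    using inner_sym_matrix_mult[of "A k" Y "A i ** Y"] sym orth k that
    by (auto simp: matrix_mul_assoc matrix_mult.zero_left)
  then have "(A k ** Y) \<bullet> (\<Sum>i=1..m. c i *\<^sub>R (A i ** Y)) =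
      (\<Sum>i=1..m. if i = k then c k * ((A k ** Y) \<bullet> (A k ** Y)) else 0)"
    unfolding inner_sum_right by (intro sum.cong) auto
  then show ?thesis
    using k by simp
qed

lemma licq_N_imp_nonzero:
  assumes "licq_N m A Y" and "k \<in> {1..m}"
  shows "A k ** Y \<noteq> 0"
proof
  assume "A k ** Y = 0"
  then have "(\<Sum>i=1..m. (if i = k then 1 else 0::real) *\<^sub>R (A i ** Y)) = 0"
    by (intro sum.neutral) auto
  with assms show False
    unfolding licq_N_def by fastforce
qed

lemma S_mat_mult:
  "S_mat grad m A lam Y ** Z =
    grad (Y ** transpose Y) ** Z - (\<Sum>i=1..m. lam i *\<^sub>R (A i ** Z))"
  by (simp add: S_mat_def matrix_mult.diff_left matrix_mult.sum_left matrix_mult.scaleR_left)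

lemma first_order_N_unique:
  assumes "licq_N m A Y" and "first_order_N grad m A b lam Y" and "first_order_N grad m A b mu Y"
  shows "\<forall>i\<in>{1..m}. mu i = lam i"
proof -
  have "(\<Sum>i=1..m. (mu i - lam i) *\<^sub>R (A i ** Y)) = 0"
    using assms(2,3) unfolding first_order_N_def S_mat_mult
    by (simp add: scaleR_diff_left sum_subtractf)
  with assms(1) have "\<forall>i\<in>{1..m}. mu i - lam i = 0"
    unfolding licq_N_def by (elim allE impE)
  then show ?thesis
    by simp
qed

text \<open>
  The hypothesis \<open>tangent\<close> says that moving \<open>Y\<close> with velocity \<open>W\<close> while adding \<open>t V\<close> preserves
  the constraints to first order; the correction of \<open>quadratic_constraint_curve\<close> then preserves
  them exactly. Local minimality in (N) and global minimality in (C) both have the form \<open>min\<close>: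
  the first uses that \<open>z\<close> stays close to \<open>Y\<close>, the second that \<open>t V\<close> is positive semidefinite.
\<close>

lemma feasible_variation:
  fixes Y :: "real^'p^'n"
  assumes grad: "has_sym_gradient f G (Y ** transpose Y)"
    and sym: "\<forall>i\<in>{1..m}. A i \<in> sym_mats"
    and orth: "\<forall>i\<in>{1..m}. \<forall>j\<in>{1..m}. i \<noteq> j \<longrightarrow> A i ** A j = 0"
    and licq: "licq_N m A Y"
    and V: "V \<in> sym_mats"
    and tangent: "\<forall>i\<in>{1..m}. 2 * ((A i ** Y) \<bullet> W) + A i \<bullet> V = 0"
    and min: "\<And>z. z \<midarrow>0\<rightarrow> Y \<Longrightarrow>
        \<forall>\<^sub>F t in at_right 0. \<forall>i\<in>{1..m}. A i \<bullet> (z t ** transpose (z t) + t *\<^sub>R V) = A i \<bullet> (Y ** transpose Y)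
        \<Longrightarrow> \<forall>\<^sub>F t in at_right 0. f (Y ** transpose Y) \<le> f (z t ** transpose (z t) + t *\<^sub>R V)"
  shows "0 \<le> 2 * ((G ** Y) \<bullet> W) + G \<bullet> V"
proof -
  obtain z where z0: "z 0 = Y" and z': "(z has_vector_derivative W) (at 0)"
    and z: "\<forall>\<^sub>F t in at 0. \<forall>k\<in>{1..m}.
      z t \<bullet> (A k ** z t) = Y \<bullet> (A k ** Y) + 2 * t * ((A k ** Y) \<bullet> W)"
  proof (rule quadratic_constraint_curve[of "{1..m}" "\<lambda>k Y. A k ** Y" Y W])
    show "linear (\<lambda>Y. A k ** Y)" for k
      by (rule bounded_linear.linear[OF matrix_mult.bounded_linear_right])
    show "(A k ** x) \<bullet> y = x \<bullet> (A k ** y)" if "k \<in> {1..m}" for k and x y :: "real^'p^'n"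
      using sym that by (simp add: inner_sym_matrix_mult)
    show "A k ** (A i ** x) = 0" if "i \<in> {1..m}" "k \<in> {1..m}" "i \<noteq> k" for i k and x :: "real^'p^'n"
      using orth that by (simp add: matrix_mul_assoc matrix_mult.zero_left)
    show "A k ** Y \<noteq> 0" if "k \<in> {1..m}" for k
      using licq that by (rule licq_N_imp_nonzero)
  qed (use that in auto)
  define x where "x t = z t ** transpose (z t) + t *\<^sub>R V" for t
  have tz: "((\<lambda>t. transpose (z t)) has_vector_derivative transpose W) (at 0)"
    using bounded_linear.has_vector_derivative[OF _ z'] linear_transpose
    by (simp add: linear_conv_bounded_linear)
  have "(x has_vector_derivative (Y ** transpose W + W ** transpose Y + V)) (at 0)"
    unfolding x_def
    by (rule has_vector_derivative_add
        [OF matrix_mult.has_vector_derivative[OF z' tz, unfolded z0]])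
      (auto intro!: derivative_eq_intros)
  then have "((\<lambda>t. f (x t)) has_real_derivative (G \<bullet> (Y ** transpose W + W ** transpose Y + V)))
      (at 0 within {0..})"
  proof (rule has_sym_gradient_along_curve[OF _ has_vector_derivative_at_within, rotated])
    show "has_sym_gradient f G (x 0)"
      using grad by (simp add: x_def z0)
    show "x ` {0..} \<subseteq> sym_mats"
      unfolding x_def using V
      by (intro image_subsetI subspace_add subspace_scale subspace_sym_mats gram_mem_sym_mats)
  qed
  moreover have "\<forall>\<^sub>F t in at_right 0. f (x 0) \<le> f (x t)"
  proof -
    have "z \<midarrow>0\<rightarrow> Y"
      using has_vector_derivative_continuous[OF z'] z0 by (simp add: isCont_def continuous_within)
    moreover have "\<forall>\<^sub>F t in at_right 0. \<forall>i\<in>{1..m}.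
        A i \<bullet> (z t ** transpose (z t) + t *\<^sub>R V) = A i \<bullet> (Y ** transpose Y)"
    proof (rule eventually_mono)
      show "\<forall>\<^sub>F t in at_right 0. \<forall>k\<in>{1..m}.
          z t \<bullet> (A k ** z t) = Y \<bullet> (A k ** Y) + 2 * t * ((A k ** Y) \<bullet> W)"
        using z by (simp add: eventually_at_split)
    next
      fix t assume t: "\<forall>k\<in>{1..m}.
          z t \<bullet> (A k ** z t) = Y \<bullet> (A k ** Y) + 2 * t * ((A k ** Y) \<bullet> W)"
      show "\<forall>i\<in>{1..m}. A i \<bullet> (z t ** transpose (z t) + t *\<^sub>R V) = A i \<bullet> (Y ** transpose Y)"
      proof
        fix i assume i: "i \<in> {1..m}"
        have "A i \<bullet> (z t ** transpose (z t) + t *\<^sub>R V) =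
            Y \<bullet> (A i ** Y) + t * (2 * ((A i ** Y) \<bullet> W) + A i \<bullet> V)"
          using t i by (simp add: inner_add_right inner_gram inner_commute algebra_simps)
        also have "\<dots> = A i \<bullet> (Y ** transpose Y)"
          using tangent i by (simp add: inner_gram inner_commute)
        finally show "A i \<bullet> (z t ** transpose (z t) + t *\<^sub>R V) = A i \<bullet> (Y ** transpose Y)" .
      qed
    qed
    ultimately show ?thesis
      using min unfolding x_def z0 by simp
  qed
  ultimately have "0 \<le> G \<bullet> (Y ** transpose W + W ** transpose Y + V)"
    by (rule derivative_nonneg_at_right_min)
  moreover have "G \<bullet> (Y ** transpose W) = (G ** Y) \<bullet> W"
    using grad inner_sym_matrix_mult[of G Y W]
    by (simp add: has_sym_gradient_def inner_gram inner_commute)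
  ultimately show ?thesis
    by (simp add: inner_add_right inner_gram)
qed

lemma feasible_N_iff:
  "Y \<in> feasible_N m A b \<longleftrightarrow> (\<forall>i\<in>{1..m}. A i \<bullet> (Y ** transpose Y) = b i)"
  by (simp add: feasible_N_def trace_quadratic inner_gram inner_commute)

lemma feasible_C_iff:
  assumes "\<forall>i\<in>{1..m}. A i \<in> sym_mats"
  shows "X \<in> feasible_C m A b \<longleftrightarrow> (\<forall>i\<in>{1..m}. A i \<bullet> X = b i) \<and> psd X"
  using assms by (simp add: feasible_C_def trace_sym_matrix_mult)

text \<open>
  As the \<open>A\<^sub>i Y\<close> are orthogonal and nonzero, the multipliers are the coefficients of the
  orthogonal projection of \<open>G Y\<close> onto their span. The residual \<open>R = S Y\<close> is tangent to the
  constraints, and \<open>f\<close> has derivative \<open>-2 \<parallel>R\<parallel>\<^sup>2\<close> in the direction \<open>-R\<close>, so minimality forces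
  \<open>R = 0\<close>.
\<close>

lemma local_minimizer_first_order:
  fixes Y :: "real^'p^'n"
  assumes grad: "has_sym_gradient f (grad (Y ** transpose Y)) (Y ** transpose Y)"
    and sym: "\<forall>i\<in>{1..m}. A i \<in> sym_mats"
    and orth: "\<forall>i\<in>{1..m}. \<forall>j\<in>{1..m}. i \<noteq> j \<longrightarrow> A i ** A j = 0"
    and licq: "licq_N m A Y"
    and loc: "local_minimizer_N f m A b Y"
  obtains lam where "first_order_N grad m A b lam Y"
proof -
  define G where "G = grad (Y ** transpose Y)"
  define lam where "lam i = ((A i ** Y) \<bullet> (G ** Y)) / ((A i ** Y) \<bullet> (A i ** Y))" for i
  define R where "R = S_mat grad m A lam Y ** Y"
  have R: "R = G ** Y - (\<Sum>i=1..m. lam i *\<^sub>R (A i ** Y))"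
    by (simp add: R_def S_mat_mult G_def)
  have AR: "(A k ** Y) \<bullet> R = 0" if k: "k \<in> {1..m}" for k
    using licq_N_imp_nonzero[OF licq k]
    by (simp add: R inner_diff_right inner_constraint_gradients_sum[OF sym orth k] lam_def
        del: One_nat_def)
  from loc obtain \<epsilon> where Y: "Y \<in> feasible_N m A b" and "\<epsilon> > 0"
    and \<epsilon>: "\<And>Y'. Y' \<in> feasible_N m A b \<Longrightarrow> dist Y' Y < \<epsilon> \<Longrightarrow>
      f (Y ** transpose Y) \<le> f (Y' ** transpose Y')"
    unfolding local_minimizer_N_def by blast
  have "0 \<le> 2 * ((G ** Y) \<bullet> (- R)) + G \<bullet> 0"
    using grad[folded G_def] sym orth licq
  proof (rule feasible_variation)
    show "0 \<in> sym_mats"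
      by (rule subspace_0[OF subspace_sym_mats])
    show "\<forall>i\<in>{1..m}. 2 * ((A i ** Y) \<bullet> (- R)) + A i \<bullet> 0 = 0"
      using AR by simp
  next
    fix z :: "real \<Rightarrow> real^'p^'n"
    assume z: "z \<midarrow>0\<rightarrow> Y" and
      feas: "\<forall>\<^sub>F t in at_right 0. \<forall>i\<in>{1..m}.
        A i \<bullet> (z t ** transpose (z t) + t *\<^sub>R 0) = A i \<bullet> (Y ** transpose Y)"
    have "\<forall>\<^sub>F t in at_right 0. dist (z t) Y < \<epsilon>"
      using tendstoD[OF z \<open>\<epsilon> > 0\<close>] by (simp add: eventually_at_split)
    with feas show "\<forall>\<^sub>F t in at_right 0. f (Y ** transpose Y) \<le> f (z t ** transpose (z t) + t *\<^sub>R 0)"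
      by eventually_elim (use Y in \<open>auto intro!: \<epsilon> simp: feasible_N_iff\<close>)
  qed
  moreover have "(G ** Y) \<bullet> R = R \<bullet> R"
  proof -
    have "G ** Y = R + (\<Sum>i=1..m. lam i *\<^sub>R (A i ** Y))"
      by (simp add: R)
    then show ?thesis
      using AR by (simp add: inner_add_left inner_sum_left)
  qed
  ultimately have "R \<bullet> R \<le> 0"
    by simp
  then have "R = 0"
    by (metis inner_eq_zero_iff inner_ge_zero order_antisym)
  then have "first_order_N grad m A b lam Y"
    using Y by (simp add: first_order_N_def R_def feasible_N_def)
  then show thesis
    by (rule that)
qed

lemma S_mat_sym:
  assumes "has_sym_gradient f (grad (Y ** transpose Y)) (Y ** transpose Y)"
    and "\<forall>i\<in>{1..m}. A i \<in> sym_mats"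
  shows "S_mat grad m A lam Y \<in> sym_mats"
  using assms unfolding S_mat_def has_sym_gradient_def
  by (intro subspace_diff subspace_sum subspace_scale subspace_sym_mats) auto

section \<open>Optimality in the convex program\<close>

text \<open>
  To test \<open>S\<close> on \<open>v\<close>, the term \<open>t v v\<^sup>T\<close> is added to \<open>Y Y\<^sup>T\<close> while \<open>Y\<close> moves within the span of the
  \<open>A\<^sub>i Y\<close> so as to keep the constraints. Because \<open>G Y = \<Sum>\<^sub>i \<lambda>\<^sub>i A\<^sub>i Y\<close>, the motion of \<open>Y\<close> contributes
  \<open>- \<Sum>\<^sub>i \<lambda>\<^sub>i \<langle>A\<^sub>i, v v\<^sup>T\<rangle>\<close> to the derivative of \<open>f\<close>, and the total is \<open>\<langle>S, v v\<^sup>T\<rangle> = v\<^sup>T S v\<close>.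
\<close>

lemma solves_C_imp_psd_S_mat:
  fixes Y :: "real^'p^'n"
  assumes grad: "has_sym_gradient f (grad (Y ** transpose Y)) (Y ** transpose Y)"
    and sym: "\<forall>i\<in>{1..m}. A i \<in> sym_mats"
    and orth: "\<forall>i\<in>{1..m}. \<forall>j\<in>{1..m}. i \<noteq> j \<longrightarrow> A i ** A j = 0"
    and licq: "licq_N m A Y"
    and fo: "first_order_N grad m A b lam Y"
    and sol: "solves_C f m A b (Y ** transpose Y)"
  shows "psd (S_mat grad m A lam Y)"
  unfolding psd_def
proof (intro conjI allI)
  show "S_mat grad m A lam Y \<in> sym_mats"
    using grad sym by (rule S_mat_sym)
next
  fix v :: "real^'n"
  define G where "G = grad (Y ** transpose Y)"
  define V where "V = columnvector v ** transpose (columnvector v :: real^1^'n)"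
  \<comment> \<open>By orthogonality of the \<open>A i ** Y\<close>, this is the choice of \<open>W\<close> in their span with
    \<open>2 * ((A i ** Y) \<bullet> W) = - (A i \<bullet> V)\<close>.\<close>
  define c where "c i = (A i \<bullet> V) / (2 * ((A i ** Y) \<bullet> (A i ** Y)))" for i
  define W where "W = - (\<Sum>i=1..m. c i *\<^sub>R (A i ** Y))"
  have "psd V"
    unfolding V_def by (rule psd_gram)
  have AW: "2 * ((A k ** Y) \<bullet> W) = - (A k \<bullet> V)" if k: "k \<in> {1..m}" for k
    using licq_N_imp_nonzero[OF licq k]
    by (simp add: W_def inner_constraint_gradients_sum[OF sym orth k] c_def
        del: One_nat_def)
  from sol have feas: "\<forall>i\<in>{1..m}. A i \<bullet> (Y ** transpose Y) = b i"
    and opt: "\<And>X. X \<in> feasible_C m A b \<Longrightarrow> f (Y ** transpose Y) \<le> f X"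
    unfolding solves_C_def is_arg_min_def by (auto simp: feasible_C_iff[OF sym] not_less)
  have "0 \<le> 2 * ((G ** Y) \<bullet> W) + G \<bullet> V"
    using grad[folded G_def] sym orth licq psdD_sym[OF \<open>psd V\<close>]
  proof (rule feasible_variation)
    show "\<forall>i\<in>{1..m}. 2 * ((A i ** Y) \<bullet> W) + A i \<bullet> V = 0"
      using AW by simp
  next
    fix z :: "real \<Rightarrow> real^'p^'n"
    assume "\<forall>\<^sub>F t in at_right 0. \<forall>i\<in>{1..m}.
        A i \<bullet> (z t ** transpose (z t) + t *\<^sub>R V) = A i \<bullet> (Y ** transpose Y)"
    moreover have "\<forall>\<^sub>F t in at_right 0. (0::real) < t"
      by (rule eventually_at_right_less)
    ultimately show "\<forall>\<^sub>F t in at_right 0.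
        f (Y ** transpose Y) \<le> f (z t ** transpose (z t) + t *\<^sub>R V)"
    proof eventually_elim
      case (elim t)
      then have "psd (z t ** transpose (z t) + t *\<^sub>R V)"
        using \<open>psd V\<close> by (intro psd_add psd_gram psd_scaleR) auto
      with elim feas show ?case
        by (intro opt) (simp add: feasible_C_iff[OF sym])
    qed
  qed
  moreover have "2 * ((G ** Y) \<bullet> W) = - (\<Sum>i=1..m. lam i * (A i \<bullet> V))"
  proof -
    have "G ** Y = (\<Sum>i=1..m. lam i *\<^sub>R (A i ** Y))"
      using fo by (simp add: first_order_N_def S_mat_mult G_def)
    then have "2 * ((G ** Y) \<bullet> W) = (\<Sum>i=1..m. lam i * (2 * ((A i ** Y) \<bullet> W)))"
      by (simp add: inner_sum_left sum_distrib_left mult.left_commute)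
    then show ?thesis
      by (simp add: AW sum_negf)
  qed
  ultimately have "0 \<le> S_mat grad m A lam Y \<bullet> V"
    by (simp add: S_mat_def G_def inner_diff_left inner_sum_left)
  then show "0 \<le> v \<bullet> (S_mat grad m A lam Y *v v)"
    by (simp add: V_def inner_rank_one)
qed

text \<open>
  This is weak duality: \<open>\<langle>G, X - X0\<rangle> = \<langle>S, X\<rangle>\<close> for every feasible \<open>X\<close>, because the constraints cancel
  the multipliers and \<open>S Y = 0\<close> gives complementary slackness \<open>\<langle>S, X0\<rangle> = 0\<close>.
\<close>

lemma psd_S_mat_imp_solves_C:
  fixes Y :: "real^'p^'n"
  assumes conv: "convex_on sym_mats f"
    and grad: "has_sym_gradient f (grad (Y ** transpose Y)) (Y ** transpose Y)"
    and sym: "\<forall>i\<in>{1..m}. A i \<in> sym_mats"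
    and fo: "first_order_N grad m A b lam Y"
    and psd: "psd (S_mat grad m A lam Y)"
  shows "solves_C f m A b (Y ** transpose Y)"
proof -
  define X0 where "X0 = Y ** transpose Y"
  define S where "S = S_mat grad m A lam Y"
  have feas: "\<forall>i\<in>{1..m}. A i \<bullet> X0 = b i" and SY: "S ** Y = 0"
    using fo by (auto simp: first_order_N_def S_def X0_def trace_quadratic inner_gram inner_commute)
  have "S \<bullet> X0 = 0"
    by (simp add: X0_def inner_gram SY)
  have "f X0 \<le> f X" if X: "\<forall>i\<in>{1..m}. A i \<bullet> X = b i" "psd X" for X
  proof -
    have "grad X0 \<bullet> (X - X0) = S \<bullet> (X - X0) + (\<Sum>i=1..m. lam i * (A i \<bullet> (X - X0)))"
      by (simp add: S_def S_mat_def X0_def inner_diff_left inner_sum_left)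
    also have "(\<Sum>i=1..m. lam i * (A i \<bullet> (X - X0))) = 0"
      using X(1) feas by (intro sum.neutral) (simp add: inner_diff_right)
    also have "S \<bullet> (X - X0) + 0 = S \<bullet> X"
      using \<open>S \<bullet> X0 = 0\<close> by (simp add: inner_diff_right)
    finally have "0 \<le> grad X0 \<bullet> (X - X0)"
      using psd_inner_nonneg[OF psd X(2)] by (simp add: S_def)
    moreover have "f X0 + grad X0 \<bullet> (X - X0) \<le> f X"
      unfolding X0_def
      by (rule convex_gradient_inequality[OF conv grad gram_mem_sym_mats psdD_sym[OF X(2)]])
    ultimately show ?thesis
      by simp
  qed
  then show ?thesis
    using feas psd_gram[of Y] unfolding solves_C_def is_arg_min_def feasible_C_iff[OF sym] X0_def
    by (auto simp: not_less)
qed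

theorem theorem1:
  fixes f :: "real^'n^'n \<Rightarrow> real"
    and grad :: "real^'n^'n \<Rightarrow> real^'n^'n"
    and m :: nat
    and A :: "nat \<Rightarrow> real^'n^'n"
    and b :: "nat \<Rightarrow> real"
    and Y :: "real^'p^'n"
  assumes "convex_on sym_mats f"
    and "\<forall>X\<in>sym_mats. has_sym_gradient f (grad X) X"
    and "\<forall>i\<in>{1..m}. A i \<in> sym_mats"
    and "\<forall>i\<in>{1..m}. \<forall>j\<in>{1..m}. i \<noteq> j \<longrightarrow> A i ** A j = 0"
    and "local_minimizer_N f m A b Y"
  shows "(licq_N m A Y \<longrightarrow>
            (\<exists>lam. first_order_N grad m A b lam Y \<and>
               (\<forall>mu. first_order_N grad m A b mu Y \<longrightarrow> (\<forall>i\<in>{1..m}. mu i = lam i)) \<and>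
               (solves_C f m A b (Y ** transpose Y) \<longleftrightarrow> psd (S_mat grad m A lam Y))))
       \<and> (\<forall>lam. first_order_N grad m A b lam Y \<and> psd (S_mat grad m A lam Y) \<longrightarrow>
            solves_C f m A b (Y ** transpose Y))"
proof -
  have grad: "has_sym_gradient f (grad (Y ** transpose Y)) (Y ** transpose Y)"
    using assms(2) gram_mem_sym_mats by blast
  note suff = psd_S_mat_imp_solves_C[where grad = grad, OF assms(1) grad assms(3)]
  show ?thesis
  proof (intro conjI impI allI)
    assume licq: "licq_N m A Y"
    obtain lam where fo: "first_order_N grad m A b lam Y"
      using local_minimizer_first_order[where grad = grad, OF grad assms(3,4) licq assms(5)] .
    show "\<exists>lam. first_order_N grad m A b lam Y \<and>
        (\<forall>mu. first_order_N grad m A b mu Y \<longrightarrow> (\<forall>i\<in>{1..m}. mu i = lam i)) \<and>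
        (solves_C f m A b (Y ** transpose Y) \<longleftrightarrow> psd (S_mat grad m A lam Y))"
    proof (intro exI[of _ lam] conjI allI impI iffI)
      show "\<forall>i\<in>{1..m}. mu i = lam i" if "first_order_N grad m A b mu Y" for mu
        using first_order_N_unique[OF licq fo that] .
      show "psd (S_mat grad m A lam Y)" if "solves_C f m A b (Y ** transpose Y)"
        using solves_C_imp_psd_S_mat[where grad = grad, OF grad assms(3,4) licq fo that] .
    qed (use fo suff in blast)+
  qed (use suff in blast)
qed

end
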